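(* Let $f,g:\mathbb{R}^d\to\mathbb{R}$ be differentiable, convex and $L$-smooth ($L>0$), and let $w^\ast$ be a solution of $\min_{w\in\mathbb{R}^d} f(w)$ subject to $g(w)\le 0$. Suppose $\tilde f:=\min_x f(x)>-\infty$ and $\tilde g:=\min_x g(x)>-\infty$, and set $\Delta_{\max}:=\max\{f(w^\ast)-\tilde f,\ g(w^\ast)-\tilde g\}\ge 0$. Let $T\ge 1$ be an integer, $w_1\in\mathbb{R}^d$, $D:=\|w_1-w^\ast\|$, and let the iterates be generated by the soft switching gradient method $$w_{t+1}=w_t-\eta F(w_t),\qquad F(w)=\sigma_\beta(g(w)-\epsilon)\nabla g(w)+[1-\sigma_\beta(g(w)-\epsilon)]\nabla f(w),$$ where $\sigma_\beta(x)=\min\{1,\max\{0,1+\beta x\}\}$. Define $$\mathcal{A}=\{t\in\{1,\dots,T\} : g(w_t)<\epsilon\},\qquad \bar w=\sum_{t\in\mathcal{A}}\alpha_t w_t,\qquad \alpha_t=\frac{1-\sigma_\beta(g(w_t)-\epsilon)}{\sum_{s\in\mathcal{A}}[1-\sigma_\beta(g(w_s)-\epsilon)]}.$$ If $$\epsilon=\frac{4LD^2}{T}+\sqrt{\frac{32LD^2\Delta_{\max}}{T}},\qquad \beta=\frac{2}{\epsilon},\qquad \eta=\min\left\{\frac{1}{2L},\ \sqrt{\frac{D^2}{2L\Delta_{\max}T}}\right\},$$ then $\mathcal{A}$ is nonempty, $\bar w$ is well-defined, and $\bar w$ is an $\epsilon$-solution, i.e. $f(\bar w)-f(w^\ast)\le\epsilon$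 and $g(\bar w)\le\epsilon$.
   Context: $\|\cdot\|$ is the Euclidean norm. The tolerance satisfies $\epsilon>0$ (so $\beta=2/\epsilon$ is defined). A differentiable function $f$ is $L$-smooth if $\|\nabla f(x)-\nabla f(y)\|\le L\|x-y\|$ for all $x,y\in\mathbb{R}^d$. When $\Delta_{\max}=0$, the second term in the minimum defining $\eta$ is read as $+\infty$, so $\eta=1/(2L)$. *)

theory Defs
  imports "HOL-Analysis.Analysis"
begin

text \<open>The value is meaningful only where \<open>f\<close> is differentiable; there \<open>GDERIV_grad\<close> applies.\<close>

definition grad :: "('a::euclidean_space \<Rightarrow> real) \<Rightarrow> 'a \<Rightarrow> 'a" where
  "grad f x = (THE D. GDERIV f x :> D)"

lemma GDERIV_unique:
  fixes f :: "'a::euclidean_space \<Rightarrow> real"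
  assumes "GDERIV f x :> D" "GDERIV f x :> E"
  shows "D = E"
proof -
  have "(\<lambda>h. h \<bullet> D) = (\<lambda>h. h \<bullet> E)"
    using has_derivative_unique assms unfolding gderiv_def by blast
  then show ?thesis
    by (metis inner_commute vector_eq_rdot)
qed

lemma grad_eqI:
  fixes f :: "'a::euclidean_space \<Rightarrow> real"
  assumes "GDERIV f x :> D"
  shows "grad f x = D"
  unfolding grad_def using assms GDERIV_unique by blast

lemma GDERIV_grad:
  fixes f :: "'a::euclidean_space \<Rightarrow> real"
  assumes "f differentiable (at x)"
  shows "GDERIV f x :> grad f x"
proof -
  obtain f' where f': "(f has_derivative f') (at x)"
    using assms unfolding differentiable_def by blast
  then have lin: "linear f'"
    by (rule has_derivative_linear)
  have "f' h = h \<bullet> adjoint f' 1" for h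
    using adjoint_works[OF lin, of h 1] by simp
  then have "f' = (\<lambda>h. h \<bullet> adjoint f' 1)"
    by blast
  then have "GDERIV f x :> adjoint f' 1"
    unfolding gderiv_def using f' by metis
  then show ?thesis
    by (simp add: grad_eqI)
qed

definition L_smooth :: "real \<Rightarrow> ('a::euclidean_space \<Rightarrow> real) \<Rightarrow> bool" where
  "L_smooth L f \<longleftrightarrow>
     (\<forall>x. f differentiable (at x)) \<and>
     (\<forall>x y. norm (grad f x - grad f y) \<le> L * norm (x - y))"

definition soft_switch :: "real \<Rightarrow> real \<Rightarrow> real" where
  "soft_switch \<beta> x = min 1 (max 0 (1 + \<beta> * x))"

definition ssg_direction ::
  "real \<Rightarrow> real \<Rightarrow> ('a::euclidean_space \<Rightarrow> real) \<Rightarrow> ('a \<Rightarrow> real) \<Rightarrow> 'a \<Rightarrow> 'a" where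
  "ssg_direction \<beta> \<epsilon> f g w =
     soft_switch \<beta> (g w - \<epsilon>) *\<^sub>R grad g w + (1 - soft_switch \<beta> (g w - \<epsilon>)) *\<^sub>R grad f w"

text \<open>For \<open>\<Delta> = 0\<close> the square-root term is to be read as infinite, whereas division by zero
  yields 0 in HOL; hence the case distinction.\<close>

definition ssg_step :: "real \<Rightarrow> real \<Rightarrow> real \<Rightarrow> nat \<Rightarrow> real" where
  "ssg_step L D \<Delta> T =
     (if \<Delta> = 0 then 1 / (2 * L) else min (1 / (2 * L)) (sqrt (D\<^sup>2 / (2 * L * \<Delta> * real T))))"

definition active_set :: "real \<Rightarrow> ('a \<Rightarrow> real) \<Rightarrow> (nat \<Rightarrow> 'a) \<Rightarrow> nat \<Rightarrow> nat set" where
  "active_set \<epsilon> g w T = {t \<in> {1..T}. g (w t) < \<epsilon>}"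

definition weight_sum ::
  "real \<Rightarrow> real \<Rightarrow> ('a \<Rightarrow> real) \<Rightarrow> (nat \<Rightarrow> 'a) \<Rightarrow> nat \<Rightarrow> real" where
  "weight_sum \<beta> \<epsilon> g w T = (\<Sum>s\<in>active_set \<epsilon> g w T. 1 - soft_switch \<beta> (g (w s) - \<epsilon>))"

definition avg_weight ::
  "real \<Rightarrow> real \<Rightarrow> ('a \<Rightarrow> real) \<Rightarrow> (nat \<Rightarrow> 'a) \<Rightarrow> nat \<Rightarrow> nat \<Rightarrow> real" where
  "avg_weight \<beta> \<epsilon> g w T t = (1 - soft_switch \<beta> (g (w t) - \<epsilon>)) / weight_sum \<beta> \<epsilon> g w T"

definition avg_iterate ::
  "real \<Rightarrow> real \<Rightarrow> ('a::real_vector \<Rightarrow> real) \<Rightarrow> (nat \<Rightarrow> 'a) \<Rightarrow> nat \<Rightarrow> 'a" where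
  "avg_iterate \<beta> \<epsilon> g w T = (\<Sum>t\<in>active_set \<epsilon> g w T. avg_weight \<beta> \<epsilon> g w T t *\<^sub>R w t)"

definition eps_solution ::
  "real \<Rightarrow> ('a \<Rightarrow> real) \<Rightarrow> ('a \<Rightarrow> real) \<Rightarrow> 'a \<Rightarrow> 'a \<Rightarrow> bool" where
  "eps_solution \<epsilon> f g wstar w \<longleftrightarrow> f w - f wstar \<le> \<epsilon> \<and> g w \<le> \<epsilon>"

end

theory Submission
  imports Defs
begin

text \<open>Let \<open>S t\<close> be the switched gap \<open>\<sigma> t * (g (w t) - g w\<^sup>*) + (1 - \<sigma> t) * (f (w t) - f w\<^sup>*)\<close>.
  Smoothness bounds squared gradients by gaps to the infimum, so the step direction satisfies
  \<open>\<parallel>F\<parallel>\<^sup>2 \<le> 2 L (S t + \<Delta>)\<close>; together with convexity this gives a one-step recursion for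
  \<open>\<parallel>w t - w\<^sup>*\<parallel>\<^sup>2\<close> that telescopes to \<open>\<Sum>t. S t \<le> T \<epsilon> / 2\<close> for the prescribed step size. As \<open>\<sigma> t\<close>
  vanishes unless \<open>g (w t) > \<epsilon> / 2\<close>, the constraint part of the sum is at least
  \<open>(\<Sum>t. \<sigma> t) \<epsilon> / 2\<close>, and what remains bounds the weighted objective gap by \<open>\<epsilon> / 2\<close>.\<close>

section \<open>Gradient inequalities from convexity and smoothness\<close>

lemma GDERIV_line:
  fixes f :: "'a::euclidean_space \<Rightarrow> real"
  assumes "f differentiable (at (x + s *\<^sub>R h))"
  shows "((\<lambda>s. f (x + s *\<^sub>R h)) has_real_derivative grad f (x + s *\<^sub>R h) \<bullet> h) (at s)"
proof -
  have "(f has_derivative (\<lambda>k. k \<bullet> grad f (x + s *\<^sub>R h))) (at (x + s *\<^sub>R h))"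
    using GDERIV_grad[OF assms] by (simp add: gderiv_def)
  moreover have "((\<lambda>s. x + s *\<^sub>R h) has_derivative (\<lambda>r. r *\<^sub>R h)) (at s)"
    by (auto intro!: derivative_eq_intros)
  ultimately have "((\<lambda>s. f (x + s *\<^sub>R h)) has_derivative (\<lambda>r. (r *\<^sub>R h) \<bullet> grad f (x + s *\<^sub>R h))) (at s)"
    by (rule has_derivative_compose[rotated])
  then show ?thesis
    by (simp add: has_field_derivative_def inner_commute mult_commute_abs)
qed

text \<open>Restricting \<open>f\<close> to the line through \<open>x\<close> and \<open>y\<close>
  reduces this to one real variable: the tangent at 0 lies below the value at 1.\<close>

lemma convex_on_above_gradient:
  fixes f :: "'a::euclidean_space \<Rightarrow> real"
  assumes "convex_on UNIV f" "f differentiable (at x)"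
  shows "f x + grad f x \<bullet> (y - x) \<le> f y"
proof -
  let ?\<phi> = "\<lambda>s. f (x + s *\<^sub>R (y - x))"
  have "convex_on UNIV ?\<phi>"
  proof (rule convex_onI)
    fix t r s :: real assume t: "0 < t" "t < 1"
    have "x + ((1 - t) *\<^sub>R r + t *\<^sub>R s) *\<^sub>R (y - x)
        = (1 - t) *\<^sub>R (x + r *\<^sub>R (y - x)) + t *\<^sub>R (x + s *\<^sub>R (y - x))"
      by (simp add: algebra_simps)
    then show "?\<phi> ((1 - t) *\<^sub>R r + t *\<^sub>R s) \<le> (1 - t) * ?\<phi> r + t * ?\<phi> s"
      using convex_onD[OF assms(1), of t] t by simp
  qed simp
  moreover have "(?\<phi> has_real_derivative grad f x \<bullet> (y - x)) (at 0)"
    using GDERIV_line[of f x 0 "y - x"] assms(2) by simp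
  ultimately have "(grad f x \<bullet> (y - x)) * (1 - 0) \<le> ?\<phi> 1 - ?\<phi> 0"
    by (intro convex_on_imp_above_tangent[where A = UNIV]) auto
  then show ?thesis by simp
qed

text \<open>Subtracting the linear term and the quadratic term from \<open>f\<close> along the
  segment leaves a nonincreasing function, because Cauchy-Schwarz and the Lipschitz gradient make
  its derivative nonpositive.\<close>

lemma L_smooth_upper_bound:
  fixes f :: "'a::euclidean_space \<Rightarrow> real"
  assumes "L_smooth L f"
  shows "f (x + h) \<le> f x + grad f x \<bullet> h + L / 2 * (norm h)\<^sup>2"
proof -
  let ?\<phi> = "\<lambda>s. f (x + s *\<^sub>R h) - s * (grad f x \<bullet> h) - L / 2 * s\<^sup>2 * (norm h)\<^sup>2"
  have "?\<phi> 1 \<le> ?\<phi> 0"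
  proof (rule DERIV_nonpos_imp_nonincreasing[where f = ?\<phi>])
    fix s :: real assume s: "0 \<le> s" "s \<le> 1"
    let ?d = "grad f (x + s *\<^sub>R h) \<bullet> h - grad f x \<bullet> h - L * s * (norm h)\<^sup>2"
    have "f differentiable (at (x + s *\<^sub>R h))"
      using assms by (simp add: L_smooth_def)
    note [derivative_intros] = GDERIV_line[OF this]
    have "(?\<phi> has_real_derivative ?d) (at s)"
      by (auto intro!: derivative_eq_intros)
    moreover have "?d \<le> 0"
    proof -
      have "(grad f (x + s *\<^sub>R h) - grad f x) \<bullet> h \<le> norm (grad f (x + s *\<^sub>R h) - grad f x) * norm h"
        by (rule norm_cauchy_schwarz)
      also have "\<dots> \<le> (L * norm (x + s *\<^sub>R h - x)) * norm h"
        using assms unfolding L_smooth_def by (intro mult_right_mono norm_ge_zero) blast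
      also have "\<dots> = L * s * (norm h)\<^sup>2"
        using s by (simp add: power2_eq_square)
      finally show ?thesis by (simp add: inner_diff_left)
    qed
    ultimately show "\<exists>d. (?\<phi> has_real_derivative d) (at s) \<and> d \<le> 0"
      by blast
  qed simp
  then show ?thesis by simp
qed

text \<open>A gradient step of length \<open>1 / L\<close> lowers \<open>f\<close> by at least the
  squared gradient norm over \<open>2 * L\<close>, yet cannot lead below the infimum.\<close>

lemma L_smooth_norm_grad_le:
  fixes f :: "'a::euclidean_space \<Rightarrow> real"
  assumes "L_smooth L f" "L > 0" "bdd_below (range f)"
  shows "(norm (grad f x))\<^sup>2 \<le> 2 * L * (f x - (INF y. f y))"
proof -
  let ?h = "- (1 / L) *\<^sub>R grad f x"
  have "(INF y. f y) \<le> f (x + ?h)"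
    using assms(3) by (rule cINF_lower) simp
  also have "\<dots> \<le> f x + grad f x \<bullet> ?h + L / 2 * (norm ?h)\<^sup>2"
    by (rule L_smooth_upper_bound[OF assms(1)])
  also have "\<dots> = f x - (norm (grad f x))\<^sup>2 / (2 * L)"
    using assms(2) by (simp add: dot_square_norm field_simps power2_eq_square)
  finally show ?thesis
    using assms(2) by (simp add: field_simps)
qed

lemma norm_convex_combination_le:
  fixes a b :: "'a::real_inner"
  assumes "0 \<le> s" "s \<le> 1"
  shows "(norm (s *\<^sub>R a + (1 - s) *\<^sub>R b))\<^sup>2 \<le> s * (norm a)\<^sup>2 + (1 - s) * (norm b)\<^sup>2"
proof -
  \<comment> \<open>The defect in the convexity of the squared norm is explicit, and its sign gives
    the claim.\<close>
  have "(norm (s *\<^sub>R a + (1 - s) *\<^sub>R b))\<^sup>2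
      = s * (norm a)\<^sup>2 + (1 - s) * (norm b)\<^sup>2 - s * (1 - s) * (norm (a - b))\<^sup>2"
    unfolding power2_norm_eq_inner
    by (simp add: inner_add inner_diff inner_commute algebra_simps)
  then show ?thesis using assms by simp
qed

section \<open>The switching weight and the step size\<close>

lemma soft_switch_bounds: "0 \<le> soft_switch \<beta> x" "soft_switch \<beta> x \<le> 1"
  by (auto simp: soft_switch_def)

lemma ssg_step_pos:
  assumes "L > 0" "D > 0" "\<Delta> \<ge> 0" "T \<ge> 1"
  shows "0 < ssg_step L D \<Delta> T"
  using assms by (auto simp: ssg_step_def)

lemma ssg_step_le: "ssg_step L D \<Delta> T \<le> 1 / (2 * L)"
  by (simp add: ssg_step_def)

text \<open>For \<Delta> > 0, \<open>1 / \<eta>\<close> is the larger of two reciprocals, hence at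
  most their sum; this accounts for \<open>2 * L * D^2\<close> and one copy of the root. The second
  copy comes from bounding \<eta> in the other term by the root entry of the minimum.\<close>

lemma ssg_step_tradeoff:
  assumes "L > 0" "D > 0" "\<Delta> \<ge> 0" "T \<ge> 1"
  defines "\<eta> \<equiv> ssg_step L D \<Delta> T"
  shows "D\<^sup>2 / \<eta> + 2 * L * \<eta> * \<Delta> * real T
    \<le> 2 * L * D\<^sup>2 + 2 * sqrt (2 * L * D\<^sup>2 * \<Delta> * real T)"
proof (cases "\<Delta> = 0")
  case True
  then show ?thesis using assms by (simp add: ssg_step_def)
next
  case False
  \<comment> \<open>Chosen so that the root entry of the step size is \<open>D / q\<close>; both
    error terms then compare with \<open>D * q\<close>.\<close>
  define q where "q = sqrt (2 * L * \<Delta> * real T)"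
  have q: "q > 0" "q\<^sup>2 = 2 * L * \<Delta> * real T"
    using False assms by (auto simp: q_def)
  have \<eta>: "\<eta> = min (1 / (2 * L)) (D / q)"
    using False assms by (simp add: ssg_step_def q_def real_sqrt_divide)
  have "sqrt (2 * L * D\<^sup>2 * \<Delta> * real T) = sqrt (D\<^sup>2 * (2 * L * \<Delta> * real T))"
    by (simp add: mult_ac)
  then have root: "sqrt (2 * L * D\<^sup>2 * \<Delta> * real T) = D * q"
    using assms by (simp add: real_sqrt_mult q_def)
  have pos: "0 < \<eta>"
    using \<eta> q assms by simp
  have "D\<^sup>2 / \<eta> \<le> 2 * L * D\<^sup>2 + D * q"
  proof (cases "1 / (2 * L) \<le> D / q")
    case True
    then show ?thesis using \<eta> q assms by (simp add: mult_ac)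
  next
    case False
    then have "\<eta> = D / q" using \<eta> by simp
    then show ?thesis using assms by (simp add: power2_eq_square)
  qed
  moreover have "2 * L * \<eta> * \<Delta> * real T = \<eta> * q\<^sup>2"
    using q by simp
  moreover have "\<eta> * q\<^sup>2 \<le> D / q * q\<^sup>2"
    using \<eta> by (intro mult_right_mono) auto
  moreover have "D / q * q\<^sup>2 = D * q"
    using q(1) by (simp add: power2_eq_square)
  ultimately show ?thesis using root by linarith
qed

text \<open>Jensen's inequality, with the hypothesis left unnormalized because the gap sums arrive
  in that form.\<close>

lemma convex_on_weighted_average_le:
  fixes h :: "'a::real_vector \<Rightarrow> real"
  assumes "convex_on UNIV h" "finite A" "\<And>t. t \<in> A \<Longrightarrow> 0 \<le> a t" "sum a A > 0"
    and "(\<Sum>t\<in>A. a t * h (w t)) \<le> c * sum a A"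
  shows "h (\<Sum>t\<in>A. (a t / sum a A) *\<^sub>R w t) \<le> c"
proof -
  have "h (\<Sum>t\<in>A. (a t / sum a A) *\<^sub>R w t) \<le> (\<Sum>t\<in>A. a t / sum a A * h (w t))"
    using assms by (intro convex_on_sum[where C = UNIV])
      (auto simp: sum_divide_distrib[symmetric] divide_nonneg_pos)
  also have "\<dots> = (\<Sum>t\<in>A. a t * h (w t)) / sum a A"
    by (simp add: sum_divide_distrib)
  also have "\<dots> \<le> c"
    using assms by (simp add: divide_le_eq)
  finally show ?thesis .
qed

text \<open>Expanding the squared distance after a step produces the gain
  \<open>2 * \<eta> * S t\<close> and a squared-direction term. The bound \<open>norm\<close>
  charges part of the latter to \<open>S t\<close>, and \<eta> \<le> \<open>1 / (2 * L)\<close>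
  keeps at least half of the gain's coefficient.\<close>

lemma gap_telescope:
  fixes w :: "nat \<Rightarrow> 'a::real_inner"
  assumes "\<eta> > 0" "L > 0" "\<eta> \<le> 1 / (2 * L)" "\<Delta> \<ge> 0"
    and step: "\<And>t. t \<ge> 1 \<Longrightarrow> w (t + 1) = w t - \<eta> *\<^sub>R F t"
    and inner: "\<And>t. t \<ge> 1 \<Longrightarrow> S t \<le> F t \<bullet> (w t - z)"
    and norm: "\<And>t. t \<ge> 1 \<Longrightarrow> (norm (F t))\<^sup>2 \<le> 2 * L * (S t + \<Delta>)"
  shows "(\<Sum>t=1..T. S t) \<le> (norm (w 1 - z))\<^sup>2 / \<eta> + 2 * L * \<eta> * \<Delta> * real T"
proof -
  let ?c = "2 * \<eta> * (1 - L * \<eta>)"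
  have one: "?c * S t \<le> (norm (w t - z))\<^sup>2 - (norm (w (Suc t) - z))\<^sup>2 + 2 * L * \<eta>\<^sup>2 * \<Delta>"
    if t: "t \<ge> 1" for t
  proof -
    have "(norm (w (Suc t) - z))\<^sup>2
        = (norm (w t - z))\<^sup>2 - 2 * \<eta> * (F t \<bullet> (w t - z)) + \<eta>\<^sup>2 * (norm (F t))\<^sup>2"
    proof -
      have "w (Suc t) - z = (w t - z) - \<eta> *\<^sub>R F t"
        using step[OF t] by simp
      show ?thesis
        unfolding \<open>w (Suc t) - z = _\<close> power2_norm_eq_inner
        by (simp add: inner_diff inner_commute algebra_simps power2_eq_square)
    qed
    moreover have "2 * \<eta> * S t \<le> 2 * \<eta> * (F t \<bullet> (w t - z))"
      using inner[OF t] assms(1) by simp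
    moreover have "\<eta>\<^sup>2 * (norm (F t))\<^sup>2 \<le> \<eta>\<^sup>2 * (2 * L * (S t + \<Delta>))"
      using norm[OF t] by (intro mult_left_mono) auto
    ultimately show ?thesis
      by (simp add: algebra_simps power2_eq_square)
  qed
  have "?c * (\<Sum>t=1..T. S t) \<le> (\<Sum>t=1..T. (norm (w t - z))\<^sup>2 - (norm (w (Suc t) - z))\<^sup>2 + 2 * L * \<eta>\<^sup>2 * \<Delta>)"
    unfolding sum_distrib_left by (intro sum_mono one) auto
  also have "\<dots> = (norm (w 1 - z))\<^sup>2 - (norm (w (Suc T) - z))\<^sup>2 + 2 * L * \<eta>\<^sup>2 * \<Delta> * real T"
    by (induction T) (auto simp: algebra_simps)
  also have "\<dots> \<le> (norm (w 1 - z))\<^sup>2 + 2 * L * \<eta>\<^sup>2 * \<Delta> * real T"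
    by simp
  also have "\<dots> = \<eta> * ((norm (w 1 - z))\<^sup>2 / \<eta> + 2 * L * \<eta> * \<Delta> * real T)" (is "_ = \<eta> * ?R")
    using assms(1) by (simp add: field_simps power2_eq_square)
  finally have bound: "?c * (\<Sum>t=1..T. S t) \<le> \<eta> * ?R" .
  have "?R \<ge> 0" using assms(1,2,4) by simp
  show ?thesis
  \<comment> \<open>Individual gaps may be negative. Replacing \<open>?c\<close> by the smaller
    \<eta> is sound only for a positive sum; otherwise the nonnegative right side suffices.\<close>
  proof (cases "(\<Sum>t=1..T. S t) \<le> 0")
    case True
    then show ?thesis using \<open>?R \<ge> 0\<close> by linarith
  next
    case False
    have "L * \<eta> \<le> 1 / 2"
      using assms(2,3) by (simp add: field_simps)
    then have "\<eta> * 1 \<le> \<eta> * (2 * (1 - L * \<eta>))"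
      using assms(1) by (intro mult_left_mono) auto
    then have "\<eta> \<le> ?c" by (simp add: mult_ac)
    then have "\<eta> * (\<Sum>t=1..T. S t) \<le> ?c * (\<Sum>t=1..T. S t)"
      using False by (intro mult_right_mono) auto
    with bound have "\<eta> * (\<Sum>t=1..T. S t) \<le> \<eta> * ?R"
      by linarith
    then show ?thesis using assms(1) by simp
  qed
qed

text \<open>The minima enter as infima of functions bounded below. Since division by zero gives 0,
  well-definedness of the average is expressed by a nonzero \<open>weight_sum\<close>.\<close>

theorem theorem4:
  fixes f g :: "real ^ 'd \<Rightarrow> real"
    and w :: "nat \<Rightarrow> real ^ 'd"
    and w1 wstar :: "real ^ 'd"
    and L D \<Delta> \<epsilon> \<beta> \<eta> :: real
    and T :: nat
  assumes "L > 0"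
    and "convex_on UNIV f" and "L_smooth L f"
    and "convex_on UNIV g" and "L_smooth L g"
    and "is_arg_min f (\<lambda>v. g v \<le> 0) wstar"
    and "bdd_below (range f)" and "bdd_below (range g)"
    and "\<Delta> = max (f wstar - (INF x. f x)) (g wstar - (INF x. g x))"
    and "T \<ge> 1"
    and "D = norm (w1 - wstar)"
    and "\<epsilon> > 0"
    and "\<epsilon> = 4 * L * D\<^sup>2 / real T + sqrt (32 * L * D\<^sup>2 * \<Delta> / real T)"
    and "\<beta> = 2 / \<epsilon>"
    and "\<eta> = ssg_step L D \<Delta> T"
    and "w 1 = w1"
    and "\<And>t. t \<ge> 1 \<Longrightarrow> w (t + 1) = w t - \<eta> *\<^sub>R ssg_direction \<beta> \<epsilon> f g (w t)"
  shows "active_set \<epsilon> g w T \<noteq> {}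
    \<and> weight_sum \<beta> \<epsilon> g w T \<noteq> 0
    \<and> eps_solution \<epsilon> f g wstar (avg_iterate \<beta> \<epsilon> g w T)"
proof -
  let ?A = "active_set \<epsilon> g w T"
  define \<sigma> where "\<sigma> t = soft_switch \<beta> (g (w t) - \<epsilon>)" for t
  define S where "S t = \<sigma> t * (g (w t) - g wstar) + (1 - \<sigma> t) * (f (w t) - f wstar)" for t
  note L = \<open>L > 0\<close> and T = \<open>T \<ge> 1\<close> and \<epsilon> = \<open>\<epsilon> > 0\<close>
  have \<sigma>: "0 \<le> \<sigma> t" "\<sigma> t \<le> 1" for t
    by (auto simp: \<sigma>_def soft_switch_bounds)
  have feas: "g wstar \<le> 0"
    using \<open>is_arg_min f (\<lambda>v. g v \<le> 0) wstar\<close> by (simp add: is_arg_min_def)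
  have infs: "(INF x. f x) \<ge> f wstar - \<Delta>" "(INF x. g x) \<ge> g wstar - \<Delta>"
    using \<open>\<Delta> = _\<close> by auto
  have "(INF x. f x) \<le> f wstar"
    using \<open>bdd_below (range f)\<close> by (rule cINF_lower) simp
  then have \<Delta>: "\<Delta> \<ge> 0"
    using \<open>\<Delta> = _\<close> by auto
  \<comment> \<open>For \<open>D = 0\<close> both summands of \<epsilon> would vanish.\<close>
  have "D \<noteq> 0"
    using \<open>\<epsilon> = _\<close> \<epsilon> by auto
  then have D: "D > 0"
    using \<open>D = _\<close> by simp
  have diff: "f differentiable (at x)" "g differentiable (at x)" for x
    using \<open>L_smooth L f\<close> \<open>L_smooth L g\<close> by (auto simp: L_smooth_def)
  have dir: "ssg_direction \<beta> \<epsilon> f g (w t) = \<sigma> t *\<^sub>R grad g (w t) + (1 - \<sigma> t) *\<^sub>R grad f (w t)" for t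
    by (simp add: ssg_direction_def \<sigma>_def)

  \<comment> \<open>The switched gap along the iterates\<close>
  have S_inner: "S t \<le> ssg_direction \<beta> \<epsilon> f g (w t) \<bullet> (w t - wstar)" for t
  proof -
    have "g (w t) - g wstar \<le> grad g (w t) \<bullet> (w t - wstar)"
      using convex_on_above_gradient[OF \<open>convex_on UNIV g\<close> diff(2), of "w t" wstar]
      by (simp add: inner_diff_right)
    moreover have "f (w t) - f wstar \<le> grad f (w t) \<bullet> (w t - wstar)"
      using convex_on_above_gradient[OF \<open>convex_on UNIV f\<close> diff(1), of "w t" wstar]
      by (simp add: inner_diff_right)
    ultimately show ?thesis
      unfolding S_def dir inner_add_left inner_scaleR_left
      using \<sigma>[of t] by (intro add_mono mult_left_mono) auto
  qed
  have S_norm: "(norm (ssg_direction \<beta> \<epsilon> f g (w t)))\<^sup>2 \<le> 2 * L * (S t + \<Delta>)" for t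
  proof -
    have "(norm (grad g (w t)))\<^sup>2 \<le> 2 * L * (g (w t) - (INF x. g x))"
      by (intro L_smooth_norm_grad_le) fact+
    also have "\<dots> \<le> 2 * L * (g (w t) - g wstar + \<Delta>)"
      using infs L by (intro mult_left_mono) auto
    finally have G: "(norm (grad g (w t)))\<^sup>2 \<le> 2 * L * (g (w t) - g wstar + \<Delta>)" .
    have "(norm (grad f (w t)))\<^sup>2 \<le> 2 * L * (f (w t) - (INF x. f x))"
      by (intro L_smooth_norm_grad_le) fact+
    also have "\<dots> \<le> 2 * L * (f (w t) - f wstar + \<Delta>)"
      using infs L by (intro mult_left_mono) auto
    finally have F: "(norm (grad f (w t)))\<^sup>2 \<le> 2 * L * (f (w t) - f wstar + \<Delta>)" .
    have "(norm (ssg_direction \<beta> \<epsilon> f g (w t)))\<^sup>2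
        \<le> \<sigma> t * (norm (grad g (w t)))\<^sup>2 + (1 - \<sigma> t) * (norm (grad f (w t)))\<^sup>2"
      unfolding dir by (intro norm_convex_combination_le \<sigma>)
    also have "\<dots> \<le> \<sigma> t * (2 * L * (g (w t) - g wstar + \<Delta>)) + (1 - \<sigma> t) * (2 * L * (f (w t) - f wstar + \<Delta>))"
      using \<sigma>[of t] G F by (intro add_mono mult_left_mono) auto
    also have "\<dots> = 2 * L * (S t + \<Delta>)"
      by (simp add: S_def algebra_simps)
    finally show ?thesis .
  qed

  have "(\<Sum>t=1..T. S t) \<le> (norm (w 1 - wstar))\<^sup>2 / \<eta> + 2 * L * \<eta> * \<Delta> * real T"
    using \<open>\<eta> = _\<close> ssg_step_pos[OF L D \<Delta> T] ssg_step_le L \<Delta> S_inner S_norm assms(17)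
    by (intro gap_telescope[where F = "\<lambda>t. ssg_direction \<beta> \<epsilon> f g (w t)"]) auto
  also have "\<dots> = D\<^sup>2 / \<eta> + 2 * L * \<eta> * \<Delta> * real T"
    using \<open>D = _\<close> \<open>w 1 = w1\<close> by simp
  also have "\<dots> \<le> 2 * L * D\<^sup>2 + 2 * sqrt (2 * L * D\<^sup>2 * \<Delta> * real T)"
    unfolding \<open>\<eta> = _\<close> by (rule ssg_step_tradeoff[OF L D \<Delta> T])
  also have "\<dots> = real T * (\<epsilon> / 2)"
  proof -
    \<comment> \<open>Pulling \<open>4 / T\<close> out of the root in \<epsilon> leaves the root of
      the step-size bound, so \<open>T / 2\<close> times it gives exactly the factor 2.\<close>
    have "32 * L * D\<^sup>2 * \<Delta> / real T = (4 / real T)\<^sup>2 * (2 * L * D\<^sup>2 * \<Delta> * real T)"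
      using T by (simp add: field_simps power2_eq_square)
    then have "sqrt (32 * L * D\<^sup>2 * \<Delta> / real T) = 4 / real T * sqrt (2 * L * D\<^sup>2 * \<Delta> * real T)"
      by (simp only: real_sqrt_mult real_sqrt_abs) simp
    then show ?thesis
      unfolding \<open>\<epsilon> = _ + _\<close> using T by (simp add: field_simps)
  qed
  finally have sum_S: "(\<Sum>t=1..T. S t) \<le> real T * (\<epsilon> / 2)" .

  \<comment> \<open>Switching weights and the active set\<close>
  have \<sigma>_ge: "\<sigma> t * (\<epsilon> / 2) \<le> \<sigma> t * (g (w t) - g wstar)" for t
  proof (cases "g (w t) \<ge> \<epsilon> / 2")
    case True
    then show ?thesis using \<sigma>[of t] feas by (intro mult_left_mono) auto
  next
    case False
    \<comment> \<open>With \<beta> = \<open>2 / \<epsilon>\<close> the ramp starts exactly where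
      \<open>g\<close> equals \<open>\<epsilon> / 2\<close>.\<close>
    then have "1 + \<beta> * (g (w t) - \<epsilon>) \<le> 0"
      unfolding \<open>\<beta> = _\<close> using \<epsilon> by (simp add: field_simps)
    then have "\<sigma> t = 0"
      by (simp add: \<sigma>_def soft_switch_def)
    then show ?thesis by simp
  qed
  have \<sigma>_one: "\<sigma> t = 1 \<longleftrightarrow> g (w t) \<ge> \<epsilon>" for t
  proof -
    have "\<sigma> t = 1 \<longleftrightarrow> 0 \<le> \<beta> * (g (w t) - \<epsilon>)"
      by (auto simp: \<sigma>_def soft_switch_def min_def max_def)
    moreover have "\<beta> > 0"
      using \<epsilon> \<open>\<beta> = _\<close> by simp
    ultimately show ?thesis
      by (simp add: zero_le_mult_iff)
  qed
  have fin: "finite ?A"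
    by (simp add: active_set_def)
  \<comment> \<open>Gap sums run over all iterations, the average only over active ones; the extra
    terms have weight 0.\<close>
  have restrict: "(\<Sum>t\<in>?A. (1 - \<sigma> t) * c t) = (\<Sum>t=1..T. (1 - \<sigma> t) * c t)" for c :: "nat \<Rightarrow> real"
  proof (rule sum.mono_neutral_left)
    show "?A \<subseteq> {1..T}"
      unfolding active_set_def by blast
    show "\<forall>t\<in>{1..T} - ?A. (1 - \<sigma> t) * c t = 0"
    proof
      fix t assume "t \<in> {1..T} - ?A"
      then have "\<sigma> t = 1"
        unfolding \<sigma>_one by (simp add: active_set_def not_less)
      then show "(1 - \<sigma> t) * c t = 0" by simp
    qed
  qed simp

  have ne: "?A \<noteq> {}"
  proof
    \<comment> \<open>Then every \<open>S t\<close> is a pure constraint gap of at least \<epsilon>,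
      while \<open>sum_S\<close> allows a mean of at most \<open>\<epsilon> / 2\<close>.\<close>
    assume "?A = {}"
    then have large: "g (w t) \<ge> \<epsilon>" if "t \<in> {1..T}" for t
      using that by (force simp: active_set_def)
    have "\<epsilon> \<le> S t" if "t \<in> {1..T}" for t
      using large[OF that] \<sigma>_one[of t] feas by (simp add: S_def)
    then have "(\<Sum>t=1..T. \<epsilon>) \<le> (\<Sum>t=1..T. S t)"
      by (rule sum_mono)
    from order_trans[OF this sum_S] have "real T * \<epsilon> \<le> real T * (\<epsilon> / 2)"
      by simp
    then show False
      using T \<epsilon> by simp
  qed
  have "1 - \<sigma> t > 0" if "t \<in> ?A" for t
    using that \<sigma>_one[of t] \<sigma>[of t] by (auto simp: active_set_def)
  then have W: "(\<Sum>t\<in>?A. 1 - \<sigma> t) > 0"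
    using fin ne by (intro sum_pos) auto
  have avg: "avg_iterate \<beta> \<epsilon> g w T = (\<Sum>t\<in>?A. ((1 - \<sigma> t) / (\<Sum>t\<in>?A. 1 - \<sigma> t)) *\<^sub>R w t)"
    by (simp add: avg_iterate_def avg_weight_def weight_sum_def \<sigma>_def)

  \<comment> \<open>Objective and constraint at the averaged iterate\<close>
  have "(\<Sum>t=1..T. (1 - \<sigma> t) * (f (w t) - f wstar)) + (\<Sum>t=1..T. \<sigma> t * (\<epsilon> / 2)) \<le> (\<Sum>t=1..T. S t)"
    unfolding sum.distrib[symmetric] S_def using \<sigma>_ge by (intro sum_mono) (simp add: add.commute)
  \<comment> \<open>The bound \<open>T * \<epsilon> / 2\<close> is split by the same weights, so
    that the constraint parts cancel.\<close>
  also have "\<dots> \<le> (\<Sum>t=1..T. (1 - \<sigma> t) * (\<epsilon> / 2)) + (\<Sum>t=1..T. \<sigma> t * (\<epsilon> / 2))"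
    using sum_S unfolding sum.distrib[symmetric] distrib_right[symmetric] by simp
  finally have "(\<Sum>t\<in>?A. (1 - \<sigma> t) * (f (w t) - f wstar)) \<le> (\<Sum>t\<in>?A. (1 - \<sigma> t) * (\<epsilon> / 2))"
    unfolding restrict by simp
  then have "(\<Sum>t\<in>?A. (1 - \<sigma> t) * f (w t)) \<le> (f wstar + \<epsilon> / 2) * (\<Sum>t\<in>?A. 1 - \<sigma> t)"
    by (simp only: right_diff_distrib sum_subtractf sum_distrib_right[symmetric])
      (simp add: algebra_simps)
  then have "f (avg_iterate \<beta> \<epsilon> g w T) \<le> f wstar + \<epsilon> / 2"
    unfolding avg using \<sigma>(2) W fin \<open>convex_on UNIV f\<close>
    by (intro convex_on_weighted_average_le[where h = f and a = "\<lambda>t. 1 - \<sigma> t"]) simp_all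
  \<comment> \<open>Each active iterate satisfies the bound on \<open>g\<close> by itself, so the
    estimate is termwise.\<close>
  moreover have "(\<Sum>t\<in>?A. (1 - \<sigma> t) * g (w t)) \<le> \<epsilon> * (\<Sum>t\<in>?A. 1 - \<sigma> t)"
  proof -
    have "(\<Sum>t\<in>?A. (1 - \<sigma> t) * g (w t)) \<le> (\<Sum>t\<in>?A. (1 - \<sigma> t) * \<epsilon>)"
      using \<sigma> by (intro sum_mono mult_left_mono) (auto simp: active_set_def)
    then show ?thesis
      by (simp add: sum_distrib_left mult.commute)
  qed
  then have "g (avg_iterate \<beta> \<epsilon> g w T) \<le> \<epsilon>"
    unfolding avg using \<sigma>(2) W fin \<open>convex_on UNIV g\<close>
    by (intro convex_on_weighted_average_le[where h = g and a = "\<lambda>t. 1 - \<sigma> t"]) simp_all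
  ultimately show ?thesis
    using ne W \<epsilon> by (simp add: eps_solution_def weight_sum_def \<sigma>_def)
qed

end
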